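(* Assume Martin's Axiom $\mathsf{MA}$ and the negation of the Continuum Hypothesis. Then $2^\omega$ has the Grinzing property.
   Context: A subset $W$ of $2^\omega$ has the Grinzing property if $W$ is uncountable and for every uncountable $Y\subseteq W$ there exist uncountable subsets $Y_\alpha$ of $Y$, for $\alpha\in\omega_1$, such that $\mathrm{cl}(Y_\alpha)\cap\mathrm{cl}(Y_\beta)=\varnothing$ whenever $\alpha\neq\beta$, where the closure is taken in $2^\omega$. $\mathsf{MA}$ is the statement that for every non-empty ccc partial order $\mathbb{P}$ and every collection $\mathcal{D}$ of fewer than $\mathfrak{c}=2^{\omega}$ dense subsets of $\mathbb{P}$ there is a filter on $\mathbb{P}$ meeting every element of $\mathcal{D}$. *)

theory Defs
  imports "HOL-Analysis.Function_Topology"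
begin

unbundle cardinal_syntax

text \<open>The Cantor space is the type of functions from \<open>nat\<close> to \<open>bool\<close>: the topological-space
  instance for functions is the product topology, and the one for \<open>bool\<close> is discrete.\<close>

type_synonym cantor = "nat \<Rightarrow> bool"

abbreviation omega1 :: "nat set rel"
  where "omega1 \<equiv> cardSuc natLeq"

abbreviation continuum :: "cantor rel"
  where "continuum \<equiv> |UNIV :: cantor set|"

definition continuum_hypothesis :: bool
  where "continuum_hypothesis \<longleftrightarrow> continuum =o omega1"

text \<open>\<open>Field omega1\<close> serves as the set of countable ordinals.\<close>

definition grinzing :: "cantor set \<Rightarrow> bool"
  where "grinzing W \<longleftrightarrow>
    uncountable W \<and>
    (\<forall>Y \<subseteq> W. uncountable Y \<longrightarrow>
      (\<exists>Z :: nat set \<Rightarrow> cantor set.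
        (\<forall>\<alpha> \<in> Field omega1. Z \<alpha> \<subseteq> Y \<and> uncountable (Z \<alpha>)) \<and>
        (\<forall>\<alpha> \<in> Field omega1. \<forall>\<beta> \<in> Field omega1.
          \<alpha> \<noteq> \<beta> \<longrightarrow> closure (Z \<alpha>) \<inter> closure (Z \<beta>) = {})))"

text \<open>Forcing convention: \<open>(p, q) \<in> r\<close> says that \<open>p\<close> is below \<open>q\<close>, that is, \<open>p\<close> is the stronger
  condition. Dense sets are dense downwards and filters are closed upwards.\<close>

definition compatible :: "'a set \<Rightarrow> 'a rel \<Rightarrow> 'a \<Rightarrow> 'a \<Rightarrow> bool"
  where "compatible P r p q \<longleftrightarrow> (\<exists>s \<in> P. (s, p) \<in> r \<and> (s, q) \<in> r)"

definition ccc_order :: "'a set \<Rightarrow> 'a rel \<Rightarrow> bool"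
  where "ccc_order P r \<longleftrightarrow>
    (\<forall>A \<subseteq> P. (\<forall>p \<in> A. \<forall>q \<in> A. p \<noteq> q \<longrightarrow> \<not> compatible P r p q) \<longrightarrow> countable A)"

definition dense_in_order :: "'a set \<Rightarrow> 'a rel \<Rightarrow> 'a set \<Rightarrow> bool"
  where "dense_in_order P r D \<longleftrightarrow> D \<subseteq> P \<and> (\<forall>p \<in> P. \<exists>d \<in> D. (d, p) \<in> r)"

definition filter_in_order :: "'a set \<Rightarrow> 'a rel \<Rightarrow> 'a set \<Rightarrow> bool"
  where "filter_in_order P r G \<longleftrightarrow>
    G \<subseteq> P \<and> G \<noteq> {} \<and>
    (\<forall>p \<in> G. \<forall>q \<in> P. (p, q) \<in> r \<longrightarrow> q \<in> G) \<and>
    (\<forall>p \<in> G. \<forall>q \<in> G. \<exists>s \<in> G. (s, p) \<in> r \<and> (s, q) \<in> r)"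

text \<open>A formula of HOL cannot quantify over types, so the type \<open>'a\<close> that contains the underlying sets
  of the partial orders is a parameter. As soon as \<open>'a\<close> has at least continuum many elements, the
  axiom for \<open>'a\<close> is equivalent to Martin's Axiom for partial orders of arbitrary size, because
  Martin's Axiom reduces to partial orders of size less than the continuum.\<close>

definition martins_axiom :: "'a itself \<Rightarrow> bool"
  where "martins_axiom _ \<longleftrightarrow>
    (\<forall>(P :: 'a set) r. partial_order_on P r \<and> P \<noteq> {} \<and> ccc_order P r \<longrightarrow>
      (\<forall>\<D>. (\<forall>D \<in> \<D>. dense_in_order P r D) \<and> |\<D>| <o continuum \<longrightarrow>
        (\<exists>G. filter_in_order P r G \<and> (\<forall>D \<in> \<D>. G \<inter> D \<noteq> {}))))"

end

theory Submission
  imports Defs "HOL-Library.Countable_Set_Type"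
begin

text \<open>Choose distinct points \<open>f (\<alpha>, \<beta>)\<close> of \<open>Y\<close> for \<open>\<alpha>, \<beta> < \<omega>\<^sub>1\<close> and colour \<open>f (\<alpha>, \<beta>)\<close> with \<open>\<alpha>\<close>,
  seen as a point of the Cantor space. A ccc forcing with finite conditions yields a function \<open>h\<close>
  that is a modulus of continuity for the colouring, from some index \<open>t x\<close> on that depends on the
  point \<open>x\<close>. By the pigeonhole principle there is an \<open>n\<close> such that, for uncountably many \<open>\<alpha>\<close>, the
  points \<open>x\<close> of colour \<open>\<alpha>\<close> with \<open>t x = n\<close> form an uncountable set. On the union of these sets \<open>h\<close> is
  a modulus of continuity from \<open>n\<close> on, so points of different colours stay apart in the closure.\<close>

section \<open>Cardinalities\<close>

lemma countable_iff_ordLess_omega1: "countable A \<longleftrightarrow> |A| <o omega1"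
  unfolding countable_card_le_natLeq
  using cardSuc_ordLeq_ordLess[OF natLeq_Card_order card_of_Card_order] by blast

lemma uncountable_iff_omega1_ordLeq: "uncountable A \<longleftrightarrow> omega1 \<le>o |A|"
  unfolding countable_iff_ordLess_omega1
  using cardSuc_Card_order[OF natLeq_Card_order]
  by (meson card_of_Well_order card_order_on_well_order_on not_ordLess_iff_ordLeq)

lemma card_of_Field_omega1: "|Field omega1| =o omega1"
  using card_of_Field_ordIso cardSuc_Card_order[OF natLeq_Card_order] by blast

lemma uncountable_Field_omega1: "uncountable (Field omega1)"
  unfolding uncountable_iff_omega1_ordLeq
  using card_of_Field_omega1 ordIso_iff_ordLeq by blast

lemma ex_inj_on_Field_omega1:
  assumes "uncountable A"
  obtains f where "inj_on f (Field omega1)" "f ` Field omega1 \<subseteq> A"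
proof -
  have "|Field omega1| \<le>o |A|"
    using assms card_of_Field_omega1 ordIso_ordLeq_trans
    unfolding uncountable_iff_omega1_ordLeq by blast
  then show ?thesis
    using that by (auto simp: card_of_ordLeq[symmetric])
qed

lemma card_of_Field_omega1_square: "|Field omega1 \<times> Field omega1| =o omega1"
  using card_of_Times_same_infinite[of "Field omega1"] uncountable_Field_omega1
    card_of_Field_omega1 ordIso_transitive uncountable_infinite by blast

lemma continuum_ordIso_Pow_nat: "continuum =o |UNIV :: nat set set|"
proof -
  have "bij_betw Collect (UNIV :: cantor set) (UNIV :: nat set set)"
    by (rule bij_betw_byWitness[where f' = "\<lambda>A x. x \<in> A"]) auto
  then show ?thesis
    using card_of_ordIso by blast
qed

lemma uncountable_cantor: "uncountable (UNIV :: cantor set)"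
proof
  assume "countable (UNIV :: cantor set)"
  then have "|UNIV :: nat set set| \<le>o |UNIV :: nat set|"
    unfolding countable_card_of_nat
    using continuum_ordIso_Pow_nat ordIso_symmetric ordIso_ordLeq_trans by blast
  then show False
    using card_of_Pow[of "UNIV :: nat set"] not_ordLess_ordLeq by auto
qed

lemma omega1_ordLess_continuum:
  assumes "\<not> continuum_hypothesis"
  shows "omega1 <o continuum"
proof -
  have "omega1 \<le>o continuum"
    using uncountable_cantor uncountable_iff_omega1_ordLeq by blast
  moreover have "\<not> omega1 =o continuum"
    using assms ordIso_symmetric unfolding continuum_hypothesis_def by blast
  ultimately show ?thesis
    using ordLeq_iff_ordLess_or_ordIso by blast
qed

lemma countable_ordLeq_continuum: "countable A \<Longrightarrow> |A| \<le>o continuum"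
  unfolding countable_iff_ordLess_omega1
  using uncountable_cantor ordLess_ordLeq_trans ordLess_imp_ordLeq
  unfolding uncountable_iff_omega1_ordLeq by blast

section \<open>Martin's Axiom\<close>

text \<open>The forcing used below does not live in \<open>'a\<close>, so the order is copied into
  \<open>'a\<close> along an injection of \<open>P\<close>. Dense sets are carried forward;
  antichains and the filter are pulled back.\<close>

lemma martins_axiomD:
  assumes ma: "martins_axiom TYPE('a)"
    and card: "|P| \<le>o |UNIV :: 'a set|"
    and po: "partial_order_on P r" and "P \<noteq> {}" and ccc: "ccc_order P r"
    and dense: "\<And>D. D \<in> \<D> \<Longrightarrow> dense_in_order P r D" and small: "|\<D>| <o continuum"
  obtains G where "filter_in_order P r G" "\<And>D. D \<in> \<D> \<Longrightarrow> G \<inter> D \<noteq> {}"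
proof -
  obtain g :: "'b \<Rightarrow> 'a" where inj: "inj_on g P"
    using card by (auto simp: card_of_ordLeq[symmetric])
  define P' where "P' = g ` P"
  define r' where "r' = map_prod g g ` r"
  define \<D>' where "\<D>' = image g ` \<D>"
  have sub: "r \<subseteq> P \<times> P" and refl: "refl_on P r" and tr: "trans r" and as: "antisym r"
    using po by (auto simp: partial_order_on_def preorder_on_def)
  have r'_iff: "(g p, g q) \<in> r' \<longleftrightarrow> (p, q) \<in> r" if pq: "p \<in> P" "q \<in> P" for p q
  proof
    assume "(g p, g q) \<in> r'"
    then obtain p1 q1 where 1: "(p1, q1) \<in> r" "g p = g p1" "g q = g q1"
      unfolding r'_def by auto
    \<comment> \<open>\<open>g\<close> is injective on \<open>P\<close> only, so the preimages have
      to lie in \<open>P\<close> before injectivity applies.\<close>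
    then have "p1 \<in> P" "q1 \<in> P"
      using sub by auto
    then have "p = p1" "q = q1"
      using 1 pq inj_onD[OF inj] by auto
    then show "(p, q) \<in> r"
      using 1 by simp
  next
    assume "(p, q) \<in> r"
    then show "(g p, g q) \<in> r'"
      unfolding r'_def by (rule map_prod_imageI)
  qed
  have r'_sub: "r' \<subseteq> P' \<times> P'"
    using sub unfolding r'_def P'_def by auto
  have refl': "refl_on P' r'"
    using refl r'_iff unfolding refl_on_def P'_def by blast
  have trans': "trans r'"
  proof (rule transI)
    fix x y z assume xy: "(x, y) \<in> r'" and yz: "(y, z) \<in> r'"
    then obtain p q s where *: "p \<in> P" "q \<in> P" "s \<in> P" "x = g p" "y = g q" "z = g s"
      using r'_sub unfolding P'_def by blast
    then have "(p, q) \<in> r" "(q, s) \<in> r"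
      using xy yz r'_iff by simp_all
    then have "(p, s) \<in> r"
      by (rule transD[OF tr])
    then show "(x, z) \<in> r'"
      using * r'_iff by simp
  qed
  have antisym': "antisym r'"
  proof (rule antisymI)
    fix x y assume xy: "(x, y) \<in> r'" and yx: "(y, x) \<in> r'"
    then obtain p q where *: "p \<in> P" "q \<in> P" "x = g p" "y = g q"
      using r'_sub unfolding P'_def by blast
    then have "(p, q) \<in> r" "(q, p) \<in> r"
      using xy yx r'_iff by simp_all
    then have "p = q"
      by (rule antisymD[OF as])
    then show "x = y"
      using * by simp
  qed
  have po': "partial_order_on P' r'"
    using r'_sub refl' trans' antisym' by (simp add: partial_order_on_def preorder_on_def)
  have compat: "compatible P' r' (g p) (g q) \<longleftrightarrow> compatible P r p q" if "p \<in> P" "q \<in> P" for p q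
    using r'_iff[OF _ that(1)] r'_iff[OF _ that(2)] unfolding compatible_def P'_def by auto
  have ccc': "ccc_order P' r'"
    unfolding ccc_order_def
  proof (intro allI impI)
    fix A assume A: "A \<subseteq> P'" and anti: "\<forall>p \<in> A. \<forall>q \<in> A. p \<noteq> q \<longrightarrow> \<not> compatible P' r' p q"
    define B where "B = {p \<in> P. g p \<in> A}"
    have "B \<subseteq> P"
      unfolding B_def by blast
    have "\<forall>p \<in> B. \<forall>q \<in> B. p \<noteq> q \<longrightarrow> \<not> compatible P r p q"
    proof (intro ballI impI)
      fix p q assume pq: "p \<in> B" "q \<in> B" "p \<noteq> q"
      then have "g p \<in> A" "g q \<in> A" "g p \<noteq> g q"
        using inj unfolding B_def inj_on_def by auto
      then have "\<not> compatible P' r' (g p) (g q)"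
        using anti by blast
      then show "\<not> compatible P r p q"
        using compat pq unfolding B_def by auto
    qed
    then have "countable B"
      using ccc \<open>B \<subseteq> P\<close> unfolding ccc_order_def by blast
    moreover have "A = g ` B"
      using A unfolding B_def P'_def by blast
    ultimately show "countable A"
      by simp
  qed
  have dense': "\<forall>D' \<in> \<D>'. dense_in_order P' r' D'"
  proof
    fix D' assume "D' \<in> \<D>'"
    then obtain D where D: "D \<in> \<D>" "D' = g ` D"
      unfolding \<D>'_def by blast
    have DP: "D \<subseteq> P" and below: "\<forall>p \<in> P. \<exists>d \<in> D. (d, p) \<in> r"
      using dense[OF D(1)] unfolding dense_in_order_def by blast+
    have "\<exists>d' \<in> g ` D. (d', g p) \<in> r'" if "p \<in> P" for p
    proof -
      from below that obtain d where "d \<in> D" "(d, p) \<in> r"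
        by (elim ballE bexE) auto
      then have "(g d, g p) \<in> r'"
        unfolding r'_def by (intro map_prod_imageI)
      then show ?thesis
        using \<open>d \<in> D\<close> by blast
    qed
    then show "dense_in_order P' r' D'"
      using DP unfolding dense_in_order_def P'_def D(2) by blast
  qed
  have small': "|\<D>'| <o continuum"
    unfolding \<D>'_def by (rule ordLeq_ordLess_trans[OF card_of_image small])
  have "P' \<noteq> {}"
    using \<open>P \<noteq> {}\<close> unfolding P'_def by simp
  with ma[unfolded martins_axiom_def, rule_format, of P' r' \<D>'] po' ccc' dense' small'
  obtain G' where G': "filter_in_order P' r' G'" "\<forall>D \<in> \<D>'. G' \<inter> D \<noteq> {}"
    by auto
  define G where "G = {p \<in> P. g p \<in> G'}"
  have G'_eq: "G' = g ` G"
    using G'(1) unfolding G_def filter_in_order_def P'_def by blast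
  have GP: "G \<subseteq> P"
    unfolding G_def by blast
  have up: "q \<in> G" if "p \<in> G" "q \<in> P" "(p, q) \<in> r" for p q
  proof -
    have "g p \<in> G'" "(g p, g q) \<in> r'" "g q \<in> P'"
      using that r'_iff unfolding G_def P'_def by auto
    then show ?thesis
      using G'(1) \<open>q \<in> P\<close> unfolding filter_in_order_def G_def by blast
  qed
  have directed: "\<exists>s \<in> G. (s, p) \<in> r \<and> (s, q) \<in> r" if pq: "p \<in> G" "q \<in> G" for p q
  proof -
    obtain s' where s': "s' \<in> G'" "(s', g p) \<in> r'" "(s', g q) \<in> r'"
      using G'(1) pq unfolding filter_in_order_def G_def by blast
    then obtain s where "s \<in> G" "s' = g s"
      using G'_eq by blast
    with s' show ?thesis
      using r'_iff pq GP by blast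
  qed
  have "G \<noteq> {}"
    using G'(1) G'_eq unfolding filter_in_order_def by blast
  then have "filter_in_order P r G"
    using GP up directed unfolding filter_in_order_def by blast
  moreover have "G \<inter> D \<noteq> {}" if "D \<in> \<D>" for D
  proof -
    have DP: "D \<subseteq> P"
      using dense[OF that] unfolding dense_in_order_def by blast
    have "G' \<inter> g ` D \<noteq> {}"
      using G'(2) that unfolding \<D>'_def by blast
    then show ?thesis
      using DP unfolding G_def by blast
  qed
  ultimately show thesis
    using that by blast
qed

section \<open>A generic modulus of continuity\<close>

definition agree :: "nat \<Rightarrow> cantor \<Rightarrow> cantor \<Rightarrow> bool"
  where "agree k x y \<longleftrightarrow> (\<forall>i<k. x i = y i)"

lemma agree_refl: "agree k x x"
  by (simp add: agree_def)

lemma agree_sym: "agree k x y \<Longrightarrow> agree k y x"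
  by (simp add: agree_def)

lemma agree_trans: "agree k x y \<Longrightarrow> agree k y z \<Longrightarrow> agree k x z"
  by (simp add: agree_def)

lemma agree_mono: "agree k x y \<Longrightarrow> l \<le> k \<Longrightarrow> agree l x y"
  by (simp add: agree_def)

lemma agree_iff_map: "agree k x y \<longleftrightarrow> map x [0..<k] = map y [0..<k]"
  by (auto simp: agree_def)

text \<open>Two distinct points differ at some coordinate, and the finitely many pairs leave room
  for a level above all these coordinates.\<close>

lemma finite_separating_level:
  assumes "finite F"
  obtains N where "\<And>x y. x \<in> F \<Longrightarrow> y \<in> F \<Longrightarrow> agree N x y \<Longrightarrow> x = y"
proof -
  define d where "d x y = (SOME i. x i \<noteq> (y i :: bool))" for x y :: cantor
  \<comment> \<open>The sum bounds each of its summands, and \<open>Suc\<close> puts every chosen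
    coordinate strictly below \<open>N\<close>. On the diagonal \<open>d\<close> is arbitrary and
    can only enlarge \<open>N\<close>.\<close>
  define N where "N = Suc (\<Sum>(x, y) \<in> F \<times> F. d x y)"
  have "x = y" if "x \<in> F" "y \<in> F" "agree N x y" for x y
  proof (rule ccontr)
    assume "x \<noteq> y"
    then have "\<exists>i. x i \<noteq> y i"
      by blast
    then have "x (d x y) \<noteq> y (d x y)"
      unfolding d_def by (rule someI_ex)
    moreover have "d x y < N"
    proof -
      have "case_prod d (x, y) \<le> (\<Sum>p \<in> F \<times> F. case_prod d p)"
        by (rule member_le_sum) (use that assms in auto)
      then show ?thesis
        unfolding N_def by simp
    qed
    ultimately show False
      using that(3) unfolding agree_def by blast
  qed
  then show thesis
    using that by blast
qed

text \<open>A finite set of tagged points can be recovered from the tagged initial segments, of all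
  lengths, of its points. There are only countably many such segments, so the finite sets inject
  into the subsets of a countable set.\<close>

lemma card_of_finite_subsets_ordLeq_continuum:
  "|Collect finite :: (cantor \<times> nat) set set| \<le>o continuum"
proof -
  define code where "code A = (\<Union>(x, i) \<in> A. \<Union>k. {(map x [0..<k], i)})" for A :: "(cantor \<times> nat) set"
  have le: "A \<subseteq> B" if "finite B" "code A = code B" for A B
  proof (rule subrelI)
    fix x i assume x: "(x, i) \<in> A"
    \<comment> \<open>\<open>N\<close> separates \<open>x\<close> from every other first coordinate
      in \<open>B\<close>, so a point of \<open>B\<close> that shares its segment of length
      \<open>N\<close> with \<open>x\<close> must be \<open>x\<close>.\<close>
    obtain N where N: "\<And>y z. y \<in> insert x (fst ` B) \<Longrightarrow> z \<in> insert x (fst ` B) \<Longrightarrow> agree N y z \<Longrightarrow> y = z"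
      using finite_separating_level[of "insert x (fst ` B)"] \<open>finite B\<close> by blast
    have "(map x [0..<N], i) \<in> code A"
      using x unfolding code_def by blast
    then have "(map x [0..<N], i) \<in> code B"
      using \<open>code A = code B\<close> by simp
    then obtain y k where y: "(y, i) \<in> B" "map x [0..<N] = map y [0..<k]"
      unfolding code_def by blast
    have "k = N"
      using arg_cong[OF y(2), of length] by simp
    then have "agree N x y"
      using y(2) by (simp only: agree_iff_map)
    moreover have "y \<in> fst ` B"
      using y(1) by force
    ultimately have "x = y"
      using N by blast
    then show "(x, i) \<in> B"
      using y(1) by simp
  qed
  have "inj_on code (Collect finite)"
    by (rule inj_onI) (use le in \<open>simp add: subset_antisym\<close>)
  then have "|Collect finite :: (cantor \<times> nat) set set| \<le>o |Pow (UNIV :: (bool list \<times> nat) set)|"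
    using card_of_ordLeq[of "Collect finite" "Pow (UNIV :: (bool list \<times> nat) set)"] by auto
  also have "|Pow (UNIV :: (bool list \<times> nat) set)| \<le>o |UNIV :: nat set set|"
  proof -
    have "inj_on (image to_nat) (Pow (UNIV :: (bool list \<times> nat) set))"
      by (intro inj_on_image_Pow inj_to_nat)
    then show ?thesis
      using card_of_ordLeq[of "Pow (UNIV :: (bool list \<times> nat) set)" "UNIV :: nat set set"] by blast
  qed
  also have "|UNIV :: nat set set| =o continuum"
    using continuum_ordIso_Pow_nat by (rule ordIso_symmetric)
  finally show ?thesis .
qed

text \<open>The list \<open>s\<close> is an initial segment of the modulus, and a pair \<open>(x, i) \<in> A\<close> promises that \<open>x\<close>
  respects the modulus from level \<open>i\<close> on.\<close>

definition obeys :: "(cantor \<Rightarrow> cantor) \<Rightarrow> nat list \<Rightarrow> (cantor \<times> nat) set \<Rightarrow> bool"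
  where "obeys c s A \<longleftrightarrow>
    (\<forall>(x, i) \<in> A. \<forall>(y, j) \<in> A. \<forall>k. i \<le> k \<and> j \<le> k \<and> k < length s \<and> agree (s ! k) x y
      \<longrightarrow> agree k (c x) (c y))"

lemma obeysI:
  assumes "\<And>x i y j k. (x, i) \<in> A \<Longrightarrow> (y, j) \<in> A \<Longrightarrow> i \<le> k \<Longrightarrow> j \<le> k \<Longrightarrow> k < length s
    \<Longrightarrow> agree (s ! k) x y \<Longrightarrow> agree k (c x) (c y)"
  shows "obeys c s A"
  using assms unfolding obeys_def by blast

lemma obeysD:
  assumes "obeys c s A" "(x, i) \<in> A" "(y, j) \<in> A" "i \<le> k" "j \<le> k" "k < length s"
    "agree (s ! k) x y"
  shows "agree k (c x) (c y)"
  using assms unfolding obeys_def by blast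

definition conditions :: "cantor set \<Rightarrow> (cantor \<Rightarrow> cantor) \<Rightarrow> (nat list \<times> (cantor \<times> nat) set) set"
  where "conditions X c = {(s, A). finite A \<and> fst ` A \<subseteq> X \<and> obeys c s A}"

text \<open>Prolonging the list keeps the values of the modulus that are already fixed, so the
  conditions in a filter fit together into one function.\<close>

definition extension_order :: "('a list \<times> 'b set) set \<Rightarrow> ('a list \<times> 'b set) rel"
  where "extension_order P =
    {((s, A), (s', A')). (s, A) \<in> P \<and> (s', A') \<in> P \<and> (\<exists>u. s = s' @ u) \<and> A' \<subseteq> A}"

lemma partial_order_extension_order: "partial_order_on P (extension_order P)"
proof -
  have "extension_order P \<subseteq> P \<times> P" "refl_on P (extension_order P)"
    unfolding extension_order_def by (auto simp: refl_on_def)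
  moreover have "trans (extension_order P)"
    unfolding extension_order_def trans_def by fastforce
  moreover have "antisym (extension_order P)"
    unfolding extension_order_def antisym_def by auto
  ultimately show ?thesis
    by (simp add: partial_order_on_def preorder_on_def)
qed

text \<open>Needed to inject the forcing into the type for which the axiom is assumed.\<close>

lemma card_of_conditions: "|conditions X c| \<le>o continuum"
proof -
  let ?L = "UNIV :: nat list set" and ?F = "Collect finite :: (cantor \<times> nat) set set"
    and ?C = "UNIV :: cantor set"
  have "conditions X c \<subseteq> ?L \<times> ?F"
    unfolding conditions_def by auto
  then have "|conditions X c| \<le>o |?L \<times> ?F|"
    by (rule card_of_mono1)
  also have "|?L \<times> ?F| \<le>o |?C \<times> ?F|"
    by (intro card_of_Times_mono1 countable_ordLeq_continuum countableI_type)
  also have "|?C \<times> ?F| \<le>o |?C \<times> ?C|"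
    by (intro card_of_Times_mono2 card_of_finite_subsets_ordLeq_continuum)
  also have "|?C \<times> ?C| =o continuum"
    using card_of_Times_same_infinite uncountable_cantor uncountable_infinite by blast
  finally show ?thesis .
qed

text \<open>The order is even \<open>\<sigma>\<close>-centred: a condition is determined up to compatibility by countably
  much information, namely \<open>s\<close> and the restrictions of the points and their colours to a level that
  exceeds all levels which \<open>s\<close> mentions.\<close>

lemma ccc_conditions: "ccc_order (conditions X c) (extension_order (conditions X c))"
proof -
  \<comment> \<open>One number that bounds the length of \<open>s\<close> and, through the sum, each
    of its entries.\<close>
  define M where "M s = length s + sum_list s" for s :: "nat list"
  define shape where "shape = (\<lambda>(s, A :: (cantor \<times> nat) set).
    (s, (\<lambda>(x, i). (map x [0..<M s], map (c x) [0..<M s], i)) ` A))"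
  have level: "s ! k \<le> M s" "k \<le> M s" if "k < length s" for s k
    using that elem_le_sum_list[OF that] unfolding M_def by linarith+
  have twin: "\<exists>x'. (x', i) \<in> B \<and> agree (M s) x x' \<and> agree (M s) (c x) (c x')"
    if eq: "shape (s, A) = shape (s, B)" and x: "(x, i) \<in> A" for s A B x i
  proof -
    let ?g = "\<lambda>(x, i). (map x [0..<M s], map (c x) [0..<M s], i)"
    have "?g ` A = ?g ` B"
      using eq unfolding shape_def by simp
    then have "?g (x, i) \<in> ?g ` B"
      using x by blast
    then obtain z where z: "?g (x, i) = ?g z" "z \<in> B"
      by (rule imageE)
    then have "(fst z, i) \<in> B" "map x [0..<M s] = map (fst z) [0..<M s]"
      "map (c x) [0..<M s] = map (c (fst z)) [0..<M s]"
      by (cases z; simp)+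
    then show ?thesis
      unfolding agree_iff_map by blast
  qed
  \<comment> \<open>A constraint between \<open>A\<close> and \<open>B\<close> is moved into
    \<open>B\<close>: the twin of \<open>x\<close> has the same promise level, agrees with
    \<open>x\<close> at least up to \<open>s ! k\<close>, and has a colour that agrees with that of
    \<open>x\<close> at least up to \<open>k\<close>.\<close>
  have cross: "agree k (c x) (c y)"
    if *: "shape (s, A) = shape (s, B)" "obeys c s B" "(x, i) \<in> A" "(y, j) \<in> B"
      "i \<le> k" "j \<le> k" "k < length s" "agree (s ! k) x y" for s A B x y i j k
  proof -
    obtain x' where x': "(x', i) \<in> B" "agree (M s) x x'" "agree (M s) (c x) (c x')"
      using twin[OF *(1,3)] by blast
    have "agree (s ! k) x' x"
      using x'(2) level(1)[OF *(7)] by (rule agree_sym[OF agree_mono])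
    then have "agree (s ! k) x' y"
      using *(8) by (rule agree_trans)
    then have "agree k (c x') (c y)"
      by (rule obeysD[OF *(2) x'(1) *(4-7)])
    moreover have "agree k (c x) (c x')"
      using x'(3) level(2)[OF *(7)] by (rule agree_mono)
    ultimately show ?thesis
      by (rule agree_trans[rotated])
  qed
  have compat: "compatible (conditions X c) (extension_order (conditions X c)) (s, A) (s, B)"
    if "shape (s, A) = shape (s, B)" "(s, A) \<in> conditions X c" "(s, B) \<in> conditions X c" for s A B
  proof -
    have ok: "obeys c s A" "obeys c s B"
      using that(2,3) unfolding conditions_def by auto
    have "obeys c s (A \<union> B)"
    proof (rule obeysI)
      fix x i y j k
      assume *: "(x, i) \<in> A \<union> B" "(y, j) \<in> A \<union> B" "i \<le> k" "j \<le> k" "k < length s"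
        "agree (s ! k) x y"
      then consider "(x, i) \<in> A" "(y, j) \<in> A" | "(x, i) \<in> A" "(y, j) \<in> B"
        | "(x, i) \<in> B" "(y, j) \<in> A" | "(x, i) \<in> B" "(y, j) \<in> B"
        by blast
      then show "agree k (c x) (c y)"
      proof cases
        case 1
        then show ?thesis using *(3-6) by (rule obeysD[OF ok(1)])
      next
        case 2
        then show ?thesis using *(3-6) by (rule cross[OF that(1) ok(2)])
      next
        case 3
        then show ?thesis using *(3-6) by (rule cross[OF that(1)[symmetric] ok(1)])
      next
        case 4
        then show ?thesis using *(3-6) by (rule obeysD[OF ok(2)])
      qed
    qed
    then have "(s, A \<union> B) \<in> conditions X c"
      using that(2,3) unfolding conditions_def by auto
    then show ?thesis
      using that(2,3) unfolding compatible_def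
      by (intro bexI[of _ "(s, A \<union> B)"]) (auto simp: extension_order_def)
  qed
  show ?thesis
    unfolding ccc_order_def
  proof (intro allI impI)
    fix C assume C: "C \<subseteq> conditions X c"
      and anti: "\<forall>p\<in>C. \<forall>q\<in>C. p \<noteq> q \<longrightarrow>
        \<not> compatible (conditions X c) (extension_order (conditions X c)) p q"
    \<comment> \<open>Conditions of equal shape are compatible, so an antichain contains at most one
      of each shape.\<close>
    have "inj_on shape C"
    proof (rule inj_onI, rule ccontr)
      fix p q assume pq: "p \<in> C" "q \<in> C" "shape p = shape q" "p \<noteq> q"
      obtain s A where p: "p = (s, A)"
        by (cases p)
      obtain B where q: "q = (s, B)"
        using pq(3) p by (cases q) (auto simp: shape_def)
      show False
        using compat[of s A B] anti[rule_format, OF pq(1,2,4)] pq(1,2,3) C unfolding p q by auto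
    qed
    moreover have "countable (shape ` C)"
    proof (rule countable_subset)
      show "shape ` C \<subseteq> UNIV \<times> Collect finite"
        using C unfolding shape_def conditions_def by auto
      show "countable ((UNIV :: nat list set) \<times> (Collect finite :: (bool list \<times> bool list \<times> nat) set set))"
        by (intro countable_SIGMA countable_Collect_finite countableI_type)
    qed
    ultimately show "countable C"
      using countable_image_inj_on by blast
  qed
qed

text \<open>A new point can be added with a promise that starts at the current length of the list:
  constraints on it would need \<open>length s \<le> k\<close> and \<open>k < length s\<close>, so
  none arise yet.\<close>

lemma dense_mentions:
  assumes "x \<in> X"
  shows "dense_in_order (conditions X c) (extension_order (conditions X c))
    {(s, A) \<in> conditions X c. \<exists>i. (x, i) \<in> A}"
proof -
  have "\<exists>d \<in> {(s, A) \<in> conditions X c. \<exists>i. (x, i) \<in> A}. (d, p) \<in> extension_order (conditions X c)"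
    if "p \<in> conditions X c" for p
  proof -
    obtain s A where p: "p = (s, A)"
      by (cases p)
    have A: "finite A" "fst ` A \<subseteq> X" "obeys c s A"
      using that unfolding p conditions_def by auto
    have "obeys c s (insert (x, length s) A)"
      by (rule obeysI) (use obeysD[OF A(3)] in fastforce)
    then have "(s, insert (x, length s) A) \<in> conditions X c"
      using A assms unfolding conditions_def by auto
    then show ?thesis
      using that unfolding p
      by (intro bexI[of _ "(s, insert (x, length s) A)"]) (auto simp: extension_order_def)
  qed
  then show ?thesis
    unfolding dense_in_order_def by blast
qed

text \<open>A level that separates the finitely many points mentioned so far is a safe value for all
  new entries, as agreement up to it forces the points to be equal.\<close>

lemma dense_longer:
  "dense_in_order (conditions X c) (extension_order (conditions X c))
    {(s, A) \<in> conditions X c. n < length s}"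
proof -
  have "\<exists>d \<in> {(s, A) \<in> conditions X c. n < length s}. (d, p) \<in> extension_order (conditions X c)"
    if "p \<in> conditions X c" for p
  proof -
    obtain s A where p: "p = (s, A)"
      by (cases p)
    have A: "finite A" "fst ` A \<subseteq> X" "obeys c s A"
      using that unfolding p conditions_def by auto
    obtain N where N: "\<And>x y. x \<in> fst ` A \<Longrightarrow> y \<in> fst ` A \<Longrightarrow> agree N x y \<Longrightarrow> x = y"
      using finite_separating_level[of "fst ` A"] A(1) by blast
    \<comment> \<open>\<open>Suc n\<close> copies suffice even when \<open>s\<close> is
      empty.\<close>
    define s' where "s' = s @ replicate (Suc n) N"
    have "obeys c s' A"
    proof (rule obeysI)
      fix x i y j k
      assume *: "(x, i) \<in> A" "(y, j) \<in> A" "i \<le> k" "j \<le> k" "k < length s'" "agree (s' ! k) x y"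
      show "agree k (c x) (c y)"
      proof (cases "k < length s")
        case True
        then have "s' ! k = s ! k"
          unfolding s'_def by (simp add: nth_append)
        then show ?thesis
          using obeysD[OF A(3)] * True by auto
      next
        case False
        then have "s' ! k = N"
          using *(5) unfolding s'_def by (auto simp: nth_append simp del: replicate_Suc)
        then have "x = y"
          using N * by (force simp: image_iff)
        then show ?thesis
          by (simp add: agree_refl)
      qed
    qed
    then have "(s', A) \<in> conditions X c"
      using A unfolding conditions_def by auto
    moreover have "n < length s'"
      unfolding s'_def by simp
    ultimately show ?thesis
      using that unfolding p
      by (intro bexI[of _ "(s', A)"]) (auto simp: extension_order_def s'_def)
  qed
  then show ?thesis
    unfolding dense_in_order_def by blast
qed

text \<open>The filter has to meet one dense set for each point of \<open>X\<close> and one for each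
  length. The lists in it then determine \<open>h\<close>, and the promises in it determine
  \<open>t\<close>.\<close>

lemma martins_axiom_modulus:
  assumes ma: "martins_axiom TYPE('a)" and large: "continuum \<le>o |UNIV :: 'a set|"
    and small: "|X| <o continuum"
  shows "\<exists>(h :: nat \<Rightarrow> nat) t. \<forall>x \<in> X. \<forall>y \<in> X. \<forall>k. t x \<le> k \<longrightarrow> t y \<le> k
    \<longrightarrow> agree (h k) x y \<longrightarrow> agree k (c x) (c y)"
proof -
  let ?P = "conditions X c"
  let ?r = "extension_order (conditions X c)"
  define D where "D x = {(s, A) \<in> ?P. \<exists>i. (x, i) \<in> A}" for x
  define E where "E n = {(s, A) \<in> ?P. n < length s}" for n
  have "|D ` X| <o continuum"
    using card_of_image small ordLeq_ordLess_trans by blast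
  moreover have "|range E| <o continuum"
  proof -
    have "|range E| \<le>o |UNIV :: nat set|"
      by (rule card_of_image)
    moreover have "|UNIV :: nat set| <o |UNIV :: nat set set|"
      using card_of_Pow[of "UNIV :: nat set"] by simp
    ultimately show ?thesis
      using continuum_ordIso_Pow_nat ordIso_symmetric ordLeq_ordLess_trans ordLess_ordIso_trans
      by blast
  qed
  ultimately have "|D ` X \<union> range E| <o continuum"
    using card_of_Un_ordLess_infinite uncountable_cantor uncountable_infinite by blast
  moreover have "dense_in_order ?P ?r C" if "C \<in> D ` X \<union> range E" for C
    using that dense_mentions dense_longer unfolding D_def E_def by blast
  moreover have "([], {}) \<in> ?P"
    unfolding conditions_def obeys_def by simp
  moreover have "|?P| \<le>o |UNIV :: 'a set|"
    using card_of_conditions large ordLeq_transitive by blast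
  ultimately obtain G where G: "filter_in_order ?P ?r G" "\<And>C. C \<in> D ` X \<union> range E \<Longrightarrow> G \<inter> C \<noteq> {}"
    using martins_axiomD[OF ma _ partial_order_extension_order _ ccc_conditions] by (metis empty_iff)
  have "\<exists>s A. (s, A) \<in> G \<and> n < length s" for n
    using G(2)[of "E n"] unfolding E_def by blast
  \<comment> \<open>For each \<open>k\<close> some condition in the filter has a list with an entry
    at \<open>k\<close>; this entry becomes \<open>h k\<close>.\<close>
  then obtain s\<^sub>h A\<^sub>h where h: "\<And>k. (s\<^sub>h k, A\<^sub>h k) \<in> G \<and> k < length (s\<^sub>h k)"
    by metis
  have "\<exists>i s A. (s, A) \<in> G \<and> (x, i) \<in> A" if "x \<in> X" for x
    using G(2)[of "D x"] that unfolding D_def by blast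
  then obtain t s\<^sub>t A\<^sub>t where t: "\<And>x. x \<in> X \<Longrightarrow> (s\<^sub>t x, A\<^sub>t x) \<in> G \<and> (x, t x) \<in> A\<^sub>t x"
    by metis
  have directed: "\<exists>s \<in> G. (s, p) \<in> ?r \<and> (s, q) \<in> ?r" if "p \<in> G" "q \<in> G" for p q
    using G(1) that unfolding filter_in_order_def by blast
  have "agree k (c x) (c y)"
    if xy: "x \<in> X" "y \<in> X" "t x \<le> k" "t y \<le> k" "agree (s\<^sub>h k ! k) x y" for x y k
  proof -
    \<comment> \<open>Two uses of directedness give a common extension \<open>q\<close> of three
      conditions: those that make the promises for \<open>x\<close> and \<open>y\<close>, and the
      one that supplies the value at \<open>k\<close>. That \<open>q\<close> obeys its own promises
      is what is needed.\<close>
    obtain p where p: "p \<in> G" "(p, (s\<^sub>t x, A\<^sub>t x)) \<in> ?r" "(p, (s\<^sub>t y, A\<^sub>t y)) \<in> ?r"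
      using directed t xy(1,2) by blast
    obtain q where q: "q \<in> G" "(q, p) \<in> ?r" "(q, (s\<^sub>h k, A\<^sub>h k)) \<in> ?r"
      using directed h p(1) by blast
    obtain s A where sA: "q = (s, A)"
      by (cases q)
    have "(x, t x) \<in> A" "(y, t y) \<in> A"
      using p q(2) t[OF xy(1)] t[OF xy(2)] unfolding sA extension_order_def by auto
    moreover have "k < length s" "s ! k = s\<^sub>h k ! k" "obeys c s A"
      using q(3) h[of k] unfolding sA extension_order_def conditions_def by (auto simp: nth_append)
    ultimately show ?thesis
      using obeysD xy(3-5) by metis
  qed
  then show ?thesis
    by (intro exI[of _ "\<lambda>k. s\<^sub>h k ! k"] exI[of _ t]) blast
qed

section \<open>Pigeonhole principle and closures in the Cantor space\<close>

lemma uncountable_fiber: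
  fixes t :: "'a \<Rightarrow> 'b::countable"
  assumes "uncountable A"
  obtains n where "uncountable {x \<in> A. t x = n}"
proof (rule ccontr)
  assume "\<not> thesis"
  then have "countable {x \<in> A. t x = n}" for n
    using that by blast
  \<comment> \<open>Otherwise countably many countable fibres would cover \<open>A\<close>.\<close>
  then have "countable (\<Union>n. {x \<in> A. t x = n})"
    by simp
  moreover have "(\<Union>n. {x \<in> A. t x = n}) = A"
    by blast
  ultimately show False
    using assms by simp
qed

text \<open>In the order of \<open>bool\<close> both singletons are rays, and rays are open.\<close>

lemma open_singleton_bool: "open {b :: bool}"
proof (cases b)
  case True
  then have "{b} = {False<..}"
    by auto
  then show ?thesis
    by simp
next
  case False
  then have "{b} = {..<True}"
    by auto
  then show ?thesis
    by simp
qed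

lemma closure_meets_cylinder:
  assumes "p \<in> closure S"
  obtains x where "x \<in> S" "agree k p x"
proof -
  \<comment> \<open>The cylinder of all points that share the first \<open>k\<close> coordinates
    with \<open>p\<close>; only finitely many factors are restricted.\<close>
  have "open (Pi\<^sub>E UNIV (\<lambda>i. if i < k then {p i} else UNIV))"
    by (rule open_PiE) (auto simp: open_singleton_bool)
  moreover have "p \<in> Pi\<^sub>E UNIV (\<lambda>i. if i < k then {p i} else UNIV)"
    by auto
  ultimately obtain x where "x \<in> S" "x \<in> Pi\<^sub>E UNIV (\<lambda>i. if i < k then {p i} else UNIV)"
    using assms unfolding closure_iff_nhds_not_empty by blast
  moreover have "agree k p x"
    unfolding agree_def
  proof (intro allI impI)
    fix i assume "i < k"
    then show "p i = x i"
      using PiE_mem[OF calculation(2), of i] by simp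
  qed
  ultimately show thesis
    using that by blast
qed

theorem theorem13:
  assumes "continuum \<le>o |UNIV :: 'a set|"
    and "martins_axiom TYPE('a)"
    and "\<not> continuum_hypothesis"
  shows "grinzing (UNIV :: cantor set)"
  unfolding grinzing_def
proof (intro conjI allI impI uncountable_cantor)
  fix Y :: "cantor set"
  assume "uncountable Y"
  let ?W = "Field omega1"
  have "|?W \<times> ?W| \<le>o |Y|"
    using card_of_Field_omega1_square \<open>uncountable Y\<close> ordIso_ordLeq_trans
    unfolding uncountable_iff_omega1_ordLeq by blast
  then obtain f where f: "inj_on f (?W \<times> ?W)" "f ` (?W \<times> ?W) \<subseteq> Y"
    using card_of_ordLeq[of "?W \<times> ?W" Y] by blast
  define X where "X = f ` (?W \<times> ?W)"
  \<comment> \<open>By injectivity of \<open>f\<close>, a point of \<open>X\<close> determines its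
    row index. This index is a set of naturals, so its characteristic function is a point of the
    Cantor space and can serve as a colour.\<close>
  define c where "c x = (\<lambda>n. n \<in> fst (inv_into (?W \<times> ?W) f x))" for x
  have c: "c (f (\<alpha>, \<beta>)) = (\<lambda>n. n \<in> \<alpha>)" if "\<alpha> \<in> ?W" "\<beta> \<in> ?W" for \<alpha> \<beta>
    using that f(1) unfolding c_def by simp
  have "|X| \<le>o omega1"
    unfolding X_def by (rule ordLeq_ordIso_trans[OF card_of_image card_of_Field_omega1_square])
  \<comment> \<open>The failure of CH enters here: it makes a family of dense sets indexed by
    \<open>X\<close> small enough for the axiom.\<close>
  then have "|X| <o continuum"
    using omega1_ordLess_continuum[OF assms(3)] by (rule ordLeq_ordLess_trans)
  from martins_axiom_modulus[OF assms(2,1) this, of c] obtain h t where modulus: "\<forall>x \<in> X. \<forall>y \<in> X. \<forall>k. t x \<le> k \<longrightarrow> t y \<le> k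
      \<longrightarrow> agree (h k) x y \<longrightarrow> agree k (c x) (c y)"
    by (elim exE)
  \<comment> \<open>Pigeonhole within one row.\<close>
  have "\<exists>n. uncountable {\<beta> \<in> ?W. t (f (\<alpha>, \<beta>)) = n}" for \<alpha>
    by (rule uncountable_fiber[OF uncountable_Field_omega1, of "\<lambda>\<beta>. t (f (\<alpha>, \<beta>))"]) (rule exI)
  then obtain m where m: "\<And>\<alpha>. uncountable {\<beta> \<in> ?W. t (f (\<alpha>, \<beta>)) = m \<alpha>}"
    using choice[of "\<lambda>\<alpha> n. uncountable {\<beta> \<in> ?W. t (f (\<alpha>, \<beta>)) = n}"] by blast
  \<comment> \<open>Pigeonhole over the rows: uncountably many share one value \<open>n\<close>, and
    \<open>e\<close> re-indexes such rows by all of \<open>Field omega1\<close>.\<close>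
  obtain n where "uncountable {\<alpha> \<in> ?W. m \<alpha> = n}"
    by (rule uncountable_fiber[OF uncountable_Field_omega1, of m])
  then obtain e where e: "inj_on e ?W" "e ` ?W \<subseteq> {\<alpha> \<in> ?W. m \<alpha> = n}"
    by (rule ex_inj_on_Field_omega1)
  define Z where "Z \<alpha> = (\<lambda>\<beta>. f (e \<alpha>, \<beta>)) ` {\<beta> \<in> ?W. t (f (e \<alpha>, \<beta>)) = n}" for \<alpha>
  have e_mem: "e \<alpha> \<in> ?W" "m (e \<alpha>) = n" if "\<alpha> \<in> ?W" for \<alpha>
    using imageI[OF that, of e] e(2) by blast+
  have Z_X: "x \<in> X" "t x = n" "c x = (\<lambda>i. i \<in> e \<alpha>)" if "\<alpha> \<in> ?W" "x \<in> Z \<alpha>" for \<alpha> x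
  proof -
    obtain \<beta> where \<beta>: "\<beta> \<in> ?W" "t (f (e \<alpha>, \<beta>)) = n" "x = f (e \<alpha>, \<beta>)"
      using \<open>x \<in> Z \<alpha>\<close> unfolding Z_def by blast
    show "x \<in> X"
      unfolding X_def \<beta>(3) using e_mem(1)[OF \<open>\<alpha> \<in> ?W\<close>] \<beta>(1) by (intro imageI SigmaI)
    show "t x = n"
      using \<beta> by simp
    show "c x = (\<lambda>i. i \<in> e \<alpha>)"
      unfolding \<beta>(3) by (rule c[OF e_mem(1)[OF \<open>\<alpha> \<in> ?W\<close>] \<beta>(1)])
  qed
  have "uncountable (Z \<alpha>)" if "\<alpha> \<in> ?W" for \<alpha>
  proof -
    have "inj_on (\<lambda>\<beta>. f (e \<alpha>, \<beta>)) {\<beta> \<in> ?W. t (f (e \<alpha>, \<beta>)) = n}"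
    proof (rule inj_onI)
      fix \<beta> \<gamma>
      assume "\<beta> \<in> {\<beta> \<in> ?W. t (f (e \<alpha>, \<beta>)) = n}" "\<gamma> \<in> {\<beta> \<in> ?W. t (f (e \<alpha>, \<beta>)) = n}"
        and "f (e \<alpha>, \<beta>) = f (e \<alpha>, \<gamma>)"
      then show "\<beta> = \<gamma>"
        using inj_onD[OF f(1), of "(e \<alpha>, \<beta>)" "(e \<alpha>, \<gamma>)"] e_mem(1)[OF that] by blast
    qed
    then show ?thesis
      using m[of "e \<alpha>"] countable_image_inj_on[of "\<lambda>\<beta>. f (e \<alpha>, \<beta>)"]
      unfolding Z_def e_mem(2)[OF that] by blast
  qed
  moreover have "closure (Z \<alpha>) \<inter> closure (Z \<beta>) = {}" if "\<alpha> \<in> ?W" "\<beta> \<in> ?W" "\<alpha> \<noteq> \<beta>" for \<alpha> \<beta>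
  proof (rule ccontr)
    assume "closure (Z \<alpha>) \<inter> closure (Z \<beta>) \<noteq> {}"
    then obtain p where p: "p \<in> closure (Z \<alpha>)" "p \<in> closure (Z \<beta>)"
      by blast
    have "e \<alpha> \<noteq> e \<beta>"
      using inj_onD[OF e(1)] that by blast
    then obtain i where i: "(i \<in> e \<alpha>) \<noteq> (i \<in> e \<beta>)"
      by blast
    \<comment> \<open>\<open>n \<le> k\<close> makes the modulus applicable to points with
      \<open>t x = n\<close>, and \<open>Suc i \<le> k\<close> brings the coordinate
      \<open>i\<close>, at which the colours differ, below \<open>k\<close>.\<close>
    define k where "k = max n (Suc i)"
    \<comment> \<open>The level \<open>h k\<close> depends on neither point, so \<open>p\<close> can
      be approximated from both sets up to the same level.\<close>
    obtain x where x: "x \<in> Z \<alpha>" "agree (h k) p x"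
      using closure_meets_cylinder[OF p(1)] by blast
    obtain y where y: "y \<in> Z \<beta>" "agree (h k) p y"
      using closure_meets_cylinder[OF p(2)] by blast
    have "agree (h k) x y"
      using x(2) y(2) agree_sym agree_trans by blast
    then have "agree k (c x) (c y)"
      using modulus[rule_format, of x y k] Z_X[OF that(1) x(1)] Z_X[OF that(2) y(1)] unfolding k_def by simp
    then show False
      using i Z_X(3)[OF that(1) x(1)] Z_X(3)[OF that(2) y(1)] unfolding agree_def k_def by auto
  qed
  moreover have "Z \<alpha> \<subseteq> Y" if "\<alpha> \<in> ?W" for \<alpha>
    using Z_X(1)[OF that] f(2) unfolding X_def by blast
  ultimately show "\<exists>Z :: nat set \<Rightarrow> cantor set.
        (\<forall>\<alpha> \<in> Field omega1. Z \<alpha> \<subseteq> Y \<and> uncountable (Z \<alpha>)) \<and>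
        (\<forall>\<alpha> \<in> Field omega1. \<forall>\<beta> \<in> Field omega1.
          \<alpha> \<noteq> \<beta> \<longrightarrow> closure (Z \<alpha>) \<inter> closure (Z \<beta>) = {})"
    by (intro exI[of _ Z] conjI ballI impI)
qed

end
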